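(* Let $G_1,G_2$ be finite groups. For $P_i\leq G_i$, $i=1,2$, denote by $\mathbf{A}_{P_1,P_2}$ the class incidence matrix of $N_{G_1}(P_1)\times N_{G_2}(P_2)$ acting (by conjugation) on the subposet of $(\mathcal{S}_{G_1\times G_2},\leq)$ consisting of those subgroups $L$ with $p_i(L)=P_i$, $i=1,2$. Then $$\mathbf{A}(\leq_P)=\bigoplus_{\substack{[P_i]\in\mathcal{S}_{G_i}/G_i\\ i=1,2}}\mathbf{A}_{P_1,P_2},$$ where $\mathbf{A}(\leq_P)$ is the class incidence matrix of the $(G_1\times G_2)$-poset $(\mathcal{S}_{G_1\times G_2},\leq_P)$.
   Context: For a finite group $G$, $\mathcal{S}_G$ is the set of subgroups of $G$, ordered by inclusion $\leq$, and $\mathcal{S}_G/G$ is the set of conjugacy classes $[H]$ of subgroups. For $L\leq G_1\times G_2$ let $p_i(L)\leq G_i$ be the projection of $L$ to $G_i$. For $L',L\leq G_1\times G_2$ write $L'\leq_P L$ if $L'\leq L$ and $p_i(L')=p_i(L)$ for $i=1,2$ (the subscript $P$ is just the name of the relation). $G_1\times G_2$ acts on $\mathcal{S}_{G_1\times G_2}$ by conjugation. Class incidence matrix: if a finite group $G$ acts on a finite poset $(X,\preceq)$ preserving the order, and $T\subseteq X$ is a transversal of the $G$-orbits, then the class incidence matrix is $(\mathbf{a}_{xy})_{x,y\in T}$ with $\mathbf{a}_{xy}=\#\{x'\in X : x'\text{ in the }G\text{-orbit of }x,\ y\preceq x'\}$. The direct sum denotes the block diagonal matrix, one block for each pair of conjugacy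 classes $([P_1],[P_2])$ with chosen representatives $P_1,P_2$; the union of the transversals used for the blocks serves as transversal of the conjugacy classes of subgroups of $G_1\times G_2$. *)

theory Defs
  imports
    "HOL-Algebra.Group_Action"
    "Jordan_Normal_Form.Matrix"
begin

section \<open>Finite posets with a group action, and class incidence matrices\<close>

locale finite_G_poset = group_action G X \<phi> for G (structure) and X and \<phi> +
  fixes leq :: "'x \<Rightarrow> 'x \<Rightarrow> bool"
  assumes finite_group: "finite (carrier G)"
    and finite_poset: "finite X"
    and poset_refl: "reflp_on X leq"
    and poset_trans: "transp_on X leq"
    and poset_antisym: "antisymp_on X leq"
    and action_mono: "\<lbrakk>g \<in> carrier G; x \<in> X; y \<in> X; leq x y\<rbrakk> \<Longrightarrow> leq (\<phi> g x) (\<phi> g y)"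

definition is_transversal ::
    "('g, 'm) monoid_scheme \<Rightarrow> 'x set \<Rightarrow> ('g \<Rightarrow> 'x \<Rightarrow> 'x) \<Rightarrow> 'x set \<Rightarrow> bool" where
  "is_transversal G X \<phi> T \<longleftrightarrow> T \<subseteq> X \<and> (\<forall>orb \<in> orbits G X \<phi>. \<exists>!x. x \<in> T \<and> x \<in> orb)"

text \<open>The matrices below have rows and columns indexed by natural numbers, so a transversal has to
  be listed in some order, without repetitions.\<close>

definition lists_transversal ::
    "('g, 'm) monoid_scheme \<Rightarrow> 'x set \<Rightarrow> ('g \<Rightarrow> 'x \<Rightarrow> 'x) \<Rightarrow> 'x list \<Rightarrow> bool" where
  "lists_transversal G X \<phi> ts \<longleftrightarrow> distinct ts \<and> is_transversal G X \<phi> (set ts)"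

text \<open>The row index is the element whose orbit is counted, the column index is the lower bound.\<close>

definition class_incidence ::
    "('g, 'm) monoid_scheme \<Rightarrow> 'x set \<Rightarrow> ('g \<Rightarrow> 'x \<Rightarrow> 'x) \<Rightarrow> ('x \<Rightarrow> 'x \<Rightarrow> bool) \<Rightarrow> 'x \<Rightarrow> 'x \<Rightarrow> nat" where
  "class_incidence G X \<phi> leq x y = card {x' \<in> X. x' \<in> orbit G \<phi> x \<and> leq y x'}"

definition class_incidence_mat ::
    "('g, 'm) monoid_scheme \<Rightarrow> 'x set \<Rightarrow> ('g \<Rightarrow> 'x \<Rightarrow> 'x) \<Rightarrow> ('x \<Rightarrow> 'x \<Rightarrow> bool) \<Rightarrow> 'x list \<Rightarrow> int mat" where
  "class_incidence_mat G X \<phi> leq ts =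
     mat (length ts) (length ts) (\<lambda>(i, j). int (class_incidence G X \<phi> leq (ts ! i) (ts ! j)))"

section \<open>Subgroups of a direct product\<close>

definition subgroups_of :: "('a, 'm) monoid_scheme \<Rightarrow> 'a set set" where
  "subgroups_of G = {H. subgroup H G}"

text \<open>Conjugation is restricted to the set acted upon because
  \<^const>\<open>group_action\<close> asks for extensional bijections.\<close>

definition conj_action :: "('a, 'm) monoid_scheme \<Rightarrow> 'a set set \<Rightarrow> 'a \<Rightarrow> 'a set \<Rightarrow> 'a set" where
  "conj_action G X g = (\<lambda>H\<in>X. g <#\<^bsub>G\<^esub> H #>\<^bsub>G\<^esub> (inv\<^bsub>G\<^esub> g))"

definition le_P :: "('a \<times> 'b) set \<Rightarrow> ('a \<times> 'b) set \<Rightarrow> bool" (infix \<open>\<le>\<^sub>P\<close> 50) where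
  "L' \<le>\<^sub>P L \<longleftrightarrow> L' \<subseteq> L \<and> fst ` L' = fst ` L \<and> snd ` L' = snd ` L"

definition subgroups_with_projections ::
    "('a, 'm) monoid_scheme \<Rightarrow> ('b, 'n) monoid_scheme \<Rightarrow> 'a set \<Rightarrow> 'b set \<Rightarrow> ('a \<times> 'b) set set" where
  "subgroups_with_projections G1 G2 P1 P2 =
     {L \<in> subgroups_of (G1 \<times>\<times> G2). fst ` L = P1 \<and> snd ` L = P2}"

definition normalizer_prod ::
    "('a, 'm) monoid_scheme \<Rightarrow> ('b, 'n) monoid_scheme \<Rightarrow> 'a set \<Rightarrow> 'b set \<Rightarrow> ('a \<times> 'b) monoid" where
  "normalizer_prod G1 G2 P1 P2 =
     G1\<lparr>carrier := normalizer G1 P1\<rparr> \<times>\<times> G2\<lparr>carrier := normalizer G2 P2\<rparr>"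

text \<open>In \<open>A_block\<close> the conjugate of a subgroup by
  an element of the product of normalizers is formed in the ambient group \<open>G1 \<times>\<times> G2\<close>.\<close>

definition A_le_P ::
    "('a, 'm) monoid_scheme \<Rightarrow> ('b, 'n) monoid_scheme \<Rightarrow> ('a \<times> 'b) set list \<Rightarrow> int mat" where
  "A_le_P G1 G2 Ls =
     class_incidence_mat (G1 \<times>\<times> G2) (subgroups_of (G1 \<times>\<times> G2))
       (conj_action (G1 \<times>\<times> G2) (subgroups_of (G1 \<times>\<times> G2))) (\<le>\<^sub>P) Ls"

definition A_block ::
    "('a, 'm) monoid_scheme \<Rightarrow> ('b, 'n) monoid_scheme \<Rightarrow> 'a set \<Rightarrow> 'b set \<Rightarrow>
     ('a \<times> 'b) set list \<Rightarrow> int mat" where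
  "A_block G1 G2 P1 P2 Ls =
     class_incidence_mat (normalizer_prod G1 G2 P1 P2) (subgroups_with_projections G1 G2 P1 P2)
       (conj_action (G1 \<times>\<times> G2) (subgroups_with_projections G1 G2 P1 P2)) (\<subseteq>) Ls"

section \<open>Both actions are actions on finite posets\<close>

lemma group_action_restrict:
  assumes "group_action G E \<phi>" and "X \<subseteq> E"
    and inv: "\<And>g x. g \<in> carrier G \<Longrightarrow> x \<in> X \<Longrightarrow> \<phi> g x \<in> X"
  shows "group_action G X (\<lambda>g. restrict (\<phi> g) X)"
proof -
  interpret group_action G E \<phi> by fact
  interpret G: group G using group_hom group_hom.axioms(1) by blast
  have bij: "restrict (\<phi> g) X \<in> Bij X" if g: "g \<in> carrier G" for g
  proof -
    have "inj_on (\<phi> g) X" using inj_prop[OF g] \<open>X \<subseteq> E\<close> by (rule inj_on_subset)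
    moreover have "\<phi> g ` X = X"
    proof
      show "\<phi> g ` X \<subseteq> X" using inv[OF g] by blast
      show "X \<subseteq> \<phi> g ` X"
      proof
        fix x assume x: "x \<in> X"
        have "\<phi> (inv\<^bsub>G\<^esub> g) x \<in> X" using inv x g by simp
        moreover have "\<phi> g (\<phi> (inv\<^bsub>G\<^esub> g) x) = x"
          using orbit_sym_aux[of "inv\<^bsub>G\<^esub> g" x] g x \<open>X \<subseteq> E\<close> by auto
        ultimately show "x \<in> \<phi> g ` X" by (metis imageI)
      qed
    qed
    ultimately show ?thesis by (simp add: Bij_def bij_betw_def)
  qed
  have "restrict (\<phi> (g \<otimes>\<^bsub>G\<^esub> h)) X = compose X (restrict (\<phi> g) X) (restrict (\<phi> h) X)"
    if "g \<in> carrier G" "h \<in> carrier G" for g h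
    using that \<open>X \<subseteq> E\<close> inv composition_rule by (auto simp: compose_def restrict_def fun_eq_iff)
  then have "(\<lambda>g. restrict (\<phi> g) X) \<in> hom G (BijGroup X)"
    by (auto simp: hom_def BijGroup_def bij)
  then show ?thesis
    by (simp add: group_action_def group_hom_def group_hom_axioms_def group_BijGroup G.is_group)
qed

lemma conj_as_image: "g <#\<^bsub>G\<^esub> H #>\<^bsub>G\<^esub> k = (\<lambda>h. g \<otimes>\<^bsub>G\<^esub> h \<otimes>\<^bsub>G\<^esub> k) ` H"
  by (auto simp: l_coset_def r_coset_def)

lemma fst_conj:
  assumes "group G1" "group G2" "g \<in> carrier (G1 \<times>\<times> G2)"
  shows "fst ` (g <#\<^bsub>G1 \<times>\<times> G2\<^esub> L #>\<^bsub>G1 \<times>\<times> G2\<^esub> (inv\<^bsub>G1 \<times>\<times> G2\<^esub> g)) =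
         fst g <#\<^bsub>G1\<^esub> fst ` L #>\<^bsub>G1\<^esub> (inv\<^bsub>G1\<^esub> fst g)"
  using assms by (cases g) (force simp: conj_as_image image_image DirProd_def inv_DirProd[unfolded DirProd_def] split: prod.splits)

lemma snd_conj:
  assumes "group G1" "group G2" "g \<in> carrier (G1 \<times>\<times> G2)"
  shows "snd ` (g <#\<^bsub>G1 \<times>\<times> G2\<^esub> L #>\<^bsub>G1 \<times>\<times> G2\<^esub> (inv\<^bsub>G1 \<times>\<times> G2\<^esub> g)) =
         snd g <#\<^bsub>G2\<^esub> snd ` L #>\<^bsub>G2\<^esub> (inv\<^bsub>G2\<^esub> snd g)"
  using assms by (cases g) (force simp: conj_as_image image_image DirProd_def inv_DirProd[unfolded DirProd_def] split: prod.splits)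

lemma finite_subgroups_of: "finite (carrier G) \<Longrightarrow> finite (subgroups_of G)"
  by (rule finite_subset[of _ "Pow (carrier G)"]) (auto simp: subgroups_of_def dest: subgroup.subset)

lemma conj_action_subgroups_of: 
  "group G \<Longrightarrow> group_action G (subgroups_of G) (conj_action G (subgroups_of G))"
  using group.action_by_conjugation_on_subgroups_set[of G]
  by (simp add: subgroups_of_def conj_action_def[abs_def])

lemma finite_G_poset_le_P:
  fixes G1 :: "('a, 'm) monoid_scheme" and G2 :: "('b, 'n) monoid_scheme"
  assumes "group G1" "finite (carrier G1)" "group G2" "finite (carrier G2)"
  shows "finite_G_poset (G1 \<times>\<times> G2) (subgroups_of (G1 \<times>\<times> G2))
           (conj_action (G1 \<times>\<times> G2) (subgroups_of (G1 \<times>\<times> G2))) (\<le>\<^sub>P)"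
proof (intro finite_G_poset.intro finite_G_poset_axioms.intro)
  show "group_action (G1 \<times>\<times> G2) (subgroups_of (G1 \<times>\<times> G2))
          (conj_action (G1 \<times>\<times> G2) (subgroups_of (G1 \<times>\<times> G2)))"
    by (intro conj_action_subgroups_of DirProd_group assms)
  show fin: "finite (carrier (G1 \<times>\<times> G2))" using assms by (simp add: DirProd_def)
  show "finite (subgroups_of (G1 \<times>\<times> G2))" by (rule finite_subgroups_of[OF fin])
  fix g and L' L assume "g \<in> carrier (G1 \<times>\<times> G2)"
    "L' \<in> subgroups_of (G1 \<times>\<times> G2)" "L \<in> subgroups_of (G1 \<times>\<times> G2)" "L' \<le>\<^sub>P L"
  then show "conj_action (G1 \<times>\<times> G2) (subgroups_of (G1 \<times>\<times> G2)) g L' \<le>\<^sub>P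
             conj_action (G1 \<times>\<times> G2) (subgroups_of (G1 \<times>\<times> G2)) g L"
    using assms by (simp add: conj_action_def le_P_def fst_conj snd_conj)
      (auto simp: conj_as_image)
qed (auto simp: le_P_def reflp_on_def transp_on_def antisymp_on_def)

lemma normalizer_conj:
  assumes "group G" "subgroup P G" "g \<in> normalizer G P"
  shows "g \<in> carrier G" "g <#\<^bsub>G\<^esub> P #>\<^bsub>G\<^esub> (inv\<^bsub>G\<^esub> g) = P"
  using assms(3) subgroup.subset[OF assms(2)] by (auto simp: normalizer_def stabilizer_def)

lemma finite_G_poset_block:
  fixes G1 :: "('a, 'm) monoid_scheme" and G2 :: "('b, 'n) monoid_scheme"
  assumes "group G1" "finite (carrier G1)" "group G2" "finite (carrier G2)"
    and P: "subgroup P1 G1" "subgroup P2 G2"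
  shows "finite_G_poset (normalizer_prod G1 G2 P1 P2) (subgroups_with_projections G1 G2 P1 P2)
           (conj_action (G1 \<times>\<times> G2) (subgroups_with_projections G1 G2 P1 P2)) (\<subseteq>)"
proof (intro finite_G_poset.intro finite_G_poset_axioms.intro)
  let ?G = "G1 \<times>\<times> G2" and ?N = "normalizer G1 P1 \<times> normalizer G2 P2"
    and ?S = "subgroups_of (G1 \<times>\<times> G2)"
  let ?X = "subgroups_with_projections G1 G2 P1 P2"
  interpret act: group_action ?G ?S "conj_action ?G ?S"
    by (intro conj_action_subgroups_of DirProd_group assms)
  have N: "normalizer_prod G1 G2 P1 P2 = ?G\<lparr>carrier := ?N\<rparr>"
    by (simp add: normalizer_prod_def DirProd_def)
  have sub: "subgroup ?N ?G"
    by (intro DirProd_subgroups assms group.normalizer_imp_subgroup subgroup.subset P)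
  have actN: "group_action (?G\<lparr>carrier := ?N\<rparr>) ?S (conj_action ?G ?S)"
    by (rule act.induced_action[OF sub])
  have NG: "g \<in> carrier ?G" if "g \<in> ?N" for g
    using subgroup.subset[OF sub] that by blast
  have XS: "?X \<subseteq> ?S" by (auto simp: subgroups_with_projections_def)
  have "conj_action ?G ?S g L \<in> ?X" if g: "g \<in> ?N" and L: "L \<in> ?X" for g L
  proof -
    have "conj_action ?G ?S g L \<in> ?S"
      using act.element_image NG[OF g] L XS by blast
    moreover have "fst g \<in> normalizer G1 P1" "snd g \<in> normalizer G2 P2" using g by auto
    ultimately show ?thesis
      using L XS assms NG[OF g] normalizer_conj(2)[OF assms(1) P(1)] normalizer_conj(2)[OF assms(3) P(2)]
      by (simp add: subgroups_with_projections_def conj_action_def fst_conj snd_conj)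
  qed
  then have "group_action (?G\<lparr>carrier := ?N\<rparr>) ?X (\<lambda>g. restrict (conj_action ?G ?S g) ?X)"
    by (intro group_action_restrict[OF actN XS]) auto
  moreover have "(\<lambda>g. restrict (conj_action ?G ?S g) ?X) = conj_action ?G ?X"
    using XS by (auto simp: conj_action_def fun_eq_iff restrict_def)
  ultimately show "group_action (normalizer_prod G1 G2 P1 P2) ?X (conj_action ?G ?X)"
    by (simp add: N)
  have fin: "finite (carrier ?G)" using assms by (simp add: DirProd_def)
  show "finite (carrier (normalizer_prod G1 G2 P1 P2))"
    using finite_subset[OF subgroup.subset[OF sub] fin] by (simp add: N)
  show "finite ?X" by (rule finite_subset[OF XS finite_subgroups_of[OF fin]])
qed (auto simp: reflp_on_def transp_on_def antisymp_on_def conj_action_def conj_as_image)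

end

theory Submission
  imports Defs
begin

text \<open>
  The projections of conjugate subgroups of \<open>G1 \<times>\<times> G2\<close> are conjugate, and \<open>y \<le>\<^sub>P x'\<close> forces equal
  projections. So an entry of the matrix of \<open>\<le>\<^sub>P\<close> vanishes unless its row and column have the same
  representative projections \<open>(P1, P2)\<close>. In that case only subgroups \<open>x'\<close> with projections \<open>P1\<close>,
  \<open>P2\<close> are counted, where \<open>\<le>\<^sub>P\<close> is inclusion and where conjugacy in \<open>G1 \<times>\<times> G2\<close> is conjugacy under
  the product of the normalizers.
\<close>

section \<open>Transversals and block diagonal matrices\<close>

text \<open>Splits unique existence into existence for each point and inequivalence of distinct
  members, so that the two can be checked separately for a union of transversals. Conversely, two
  members of \<open>T\<close> in the orbit of \<open>x\<close> lie in each other's orbit by symmetry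
  and transitivity, hence coincide.\<close>

lemma (in group_action) is_transversal_iff:
  "is_transversal G E \<phi> T \<longleftrightarrow>
     T \<subseteq> E \<and> (\<forall>x\<in>E. \<exists>t\<in>T. t \<in> orbit G \<phi> x) \<and>
     (\<forall>s\<in>T. \<forall>t\<in>T. t \<in> orbit G \<phi> s \<longrightarrow> t = s)"
  (is "_ \<longleftrightarrow> ?R")
proof
  assume T: "is_transversal G E \<phi> T"
  then have "T \<subseteq> E" by (simp add: is_transversal_def)
  have ex1: "\<exists>!t. t \<in> T \<and> t \<in> orbit G \<phi> x" if "x \<in> E" for x
    using T that by (auto simp: is_transversal_def orbits_def)
  have "t = s" if "s \<in> T" "t \<in> T" "t \<in> orbit G \<phi> s" for s t
    using ex1[of s] orbit_refl[of s] that \<open>T \<subseteq> E\<close> by blast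
  then show ?R using \<open>T \<subseteq> E\<close> ex1 by blast
next
  assume R: ?R
  have "s = t" if "x \<in> E" "s \<in> T" "s \<in> orbit G \<phi> x" "t \<in> T" "t \<in> orbit G \<phi> x" for x s t
  proof -
    have "s \<in> E" "t \<in> E" using R that by auto
    then have "x \<in> orbit G \<phi> s" using orbit_sym that by blast
    then have "t \<in> orbit G \<phi> s" using orbit_trans \<open>s \<in> E\<close> \<open>t \<in> E\<close> that by blast
    then show ?thesis using R that by blast
  qed
  then show "is_transversal G E \<phi> T"
    using R unfolding is_transversal_def orbits_def by blast
qed

text \<open>Induction on \<open>ks\<close>, splitting off the block of the first key. Distinctness
  separates this key from all later ones, and the hypothesis covers both orders of two keys, so both
  off-diagonal blocks are zero.\<close>

lemma mat_concat_eq_diag_block_mat: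
  fixes F :: "'x \<Rightarrow> 'x \<Rightarrow> 'c :: zero"
  defines "M \<equiv> \<lambda>xs. mat (length xs) (length xs) (\<lambda>(i, j). F (xs ! i) (xs ! j))"
  assumes "distinct ks"
    and "\<And>p q x y. \<lbrakk>p \<in> set ks; q \<in> set ks; p \<noteq> q; x \<in> set (g p); y \<in> set (g q)\<rbrakk> \<Longrightarrow> F x y = 0"
  shows "M (concat (map g ks)) = diag_block_mat (map (\<lambda>p. M (g p)) ks)"
  using assms(2-)
proof (induction ks)
  case Nil
  then show ?case by (auto simp: M_def)
next
  case (Cons k ks)
  let ?ys = "concat (map g ks)"
  have IH: "diag_block_mat (map (\<lambda>p. M (g p)) ks) = M ?ys"
  proof (rule Cons.IH[symmetric])
    show "F x y = 0" if "p \<in> set ks" "q \<in> set ks" "p \<noteq> q" "x \<in> set (g p)" "y \<in> set (g q)" for p q x y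
      using that by (intro Cons.prems(2)[of p q]) auto
  qed (use Cons.prems(1) in simp)
  have off: "F x y = 0" "F y x = 0" if "x \<in> set (g k)" "y \<in> set ?ys" for x y
    using that Cons.prems by auto
  have "M (g k @ ?ys) = four_block_mat (M (g k)) (0\<^sub>m (length (g k)) (length ?ys))
      (0\<^sub>m (length ?ys) (length (g k))) (M ?ys)"
    by (rule eq_matI) (auto simp: M_def nth_append off simp del: set_concat set_map)
  then show ?case by (simp add: IH Let_def) (simp add: M_def)
qed

section \<open>Conjugation orbits and projections\<close>

text \<open>The acting group \<open>M\<close> is kept apart from the group \<open>G\<close> in which
  conjugates are formed, so that the product of normalizers can act by conjugation in the ambient
  product.\<close>

lemma orbit_conj_action:
  "H \<in> X \<Longrightarrow> orbit M (conj_action G X) H =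
    {g <#\<^bsub>G\<^esub> H #>\<^bsub>G\<^esub> (inv\<^bsub>G\<^esub> g) | g. g \<in> carrier M}"
  by (auto simp: orbit_def conj_action_def)

lemma mem_normalizer_iff:
  "H \<subseteq> carrier G \<Longrightarrow>
    g \<in> normalizer G H \<longleftrightarrow> g \<in> carrier G \<and> g <#\<^bsub>G\<^esub> H #>\<^bsub>G\<^esub> (inv\<^bsub>G\<^esub> g) = H"
  by (simp add: normalizer_def stabilizer_def)

lemma subgroup_fst_image:
  assumes "group G1" "group G2" "subgroup L (G1 \<times>\<times> G2)"
  shows "subgroup (fst ` L) G1"
proof -
  interpret group_hom "G1 \<times>\<times> G2" G1 fst
    by (auto simp: group_hom_def group_hom_axioms_def hom_def DirProd_group assms)
  show ?thesis by (rule subgroup_img_is_subgroup[OF assms(3)])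
qed

lemma subgroup_snd_image:
  assumes "group G1" "group G2" "subgroup L (G1 \<times>\<times> G2)"
  shows "subgroup (snd ` L) G2"
proof -
  interpret group_hom "G1 \<times>\<times> G2" G2 snd
    by (auto simp: group_hom_def group_hom_axioms_def hom_def DirProd_group assms)
  show ?thesis by (rule subgroup_img_is_subgroup[OF assms(3)])
qed

text \<open>If \<open>g\<close> conjugates \<open>L\<close> to \<open>K\<close>, then the components
  of \<open>g\<close> conjugate the projections of \<open>L\<close> to those of
  \<open>K\<close>.\<close>

lemma orbit_projections:
  assumes "group G1" "group G2" "subgroup L (G1 \<times>\<times> G2)"
    and "K \<in> orbit (G1 \<times>\<times> G2) (conj_action (G1 \<times>\<times> G2) (subgroups_of (G1 \<times>\<times> G2))) L"
  shows "fst ` K \<in> orbit G1 (conj_action G1 (subgroups_of G1)) (fst ` L)"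
    and "snd ` K \<in> orbit G2 (conj_action G2 (subgroups_of G2)) (snd ` L)"
proof -
  let ?G = "G1 \<times>\<times> G2"
  have L: "L \<in> subgroups_of ?G" "fst ` L \<in> subgroups_of G1" "snd ` L \<in> subgroups_of G2"
    using assms(3) subgroup_fst_image[OF assms(1-3)] subgroup_snd_image[OF assms(1-3)]
    by (auto simp: subgroups_of_def)
  obtain g where g: "g \<in> carrier ?G" "K = g <#\<^bsub>?G\<^esub> L #>\<^bsub>?G\<^esub> (inv\<^bsub>?G\<^esub> g)"
    using assms(4) by (auto simp only: orbit_conj_action[OF L(1)])
  have "fst g \<in> carrier G1" "snd g \<in> carrier G2"
    using g(1) by auto
  then show "fst ` K \<in> orbit G1 (conj_action G1 (subgroups_of G1)) (fst ` L)"
    and "snd ` K \<in> orbit G2 (conj_action G2 (subgroups_of G2)) (snd ` L)"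
    using fst_conj[OF assms(1,2) g(1)] snd_conj[OF assms(1,2) g(1)]
    by (auto simp only: g(2) orbit_conj_action[OF L(2)] orbit_conj_action[OF L(3)])
qed

text \<open>An element conjugating one subgroup with projections \<open>P1\<close>, \<open>P2\<close> to another one
  normalizes both projections.\<close>

lemma orbit_normalizer_prod:
  assumes "group G1" "group G2" and L: "L \<in> subgroups_with_projections G1 G2 P1 P2"
  shows "orbit (normalizer_prod G1 G2 P1 P2)
           (conj_action (G1 \<times>\<times> G2) (subgroups_with_projections G1 G2 P1 P2)) L =
         orbit (G1 \<times>\<times> G2) (conj_action (G1 \<times>\<times> G2) (subgroups_of (G1 \<times>\<times> G2))) L \<inter>
           subgroups_with_projections G1 G2 P1 P2"
    (is "?N = ?O \<inter> ?X")
proof -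
  let ?G = "G1 \<times>\<times> G2"
  let ?c = "\<lambda>g. g <#\<^bsub>?G\<^esub> L #>\<^bsub>?G\<^esub> (inv\<^bsub>?G\<^esub> g)"
  interpret act: group_action ?G "subgroups_of ?G" "conj_action ?G (subgroups_of ?G)"
    by (intro conj_action_subgroups_of DirProd_group assms)
  have L': "L \<in> subgroups_of ?G" "fst ` L = P1" "snd ` L = P2"
    using L by (auto simp: subgroups_with_projections_def)
  then have "subgroup P1 G1" "subgroup P2 G2"
    using subgroup_fst_image subgroup_snd_image assms by (auto simp: subgroups_of_def)
  then have P: "P1 \<subseteq> carrier G1" "P2 \<subseteq> carrier G2"
    using subgroup.subset by auto
  have "?c g \<in> subgroups_of ?G" if "g \<in> carrier ?G" for g
    using act.element_image[OF that L'(1) refl] L'(1) by (simp add: conj_action_def)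
  moreover have "fst ` ?c g = fst g <#\<^bsub>G1\<^esub> P1 #>\<^bsub>G1\<^esub> (inv\<^bsub>G1\<^esub> fst g)"
      "snd ` ?c g = snd g <#\<^bsub>G2\<^esub> P2 #>\<^bsub>G2\<^esub> (inv\<^bsub>G2\<^esub> snd g)" if "g \<in> carrier ?G" for g
    using fst_conj[OF assms(1,2) that, of L] snd_conj[OF assms(1,2) that, of L] L'(2,3) by simp_all
  moreover have "g \<in> carrier (normalizer_prod G1 G2 P1 P2) \<longleftrightarrow> g \<in> carrier ?G \<and>
      fst g <#\<^bsub>G1\<^esub> P1 #>\<^bsub>G1\<^esub> (inv\<^bsub>G1\<^esub> fst g) = P1 \<and>
      snd g <#\<^bsub>G2\<^esub> P2 #>\<^bsub>G2\<^esub> (inv\<^bsub>G2\<^esub> snd g) = P2" for g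
    by (cases g) (auto simp add: normalizer_prod_def mem_normalizer_iff P)
  \<comment> \<open>Every conjugate of \<open>L\<close> is again a subgroup, so membership of
    \<open>?c g\<close> in \<open>?X\<close> only tests its two projections; these are
    \<open>P1\<close> and \<open>P2\<close> exactly when the components of \<open>g\<close>
    normalize \<open>P1\<close> and \<open>P2\<close>.\<close>
  ultimately have "g \<in> carrier (normalizer_prod G1 G2 P1 P2) \<longleftrightarrow> g \<in> carrier ?G \<and> ?c g \<in> ?X" for g
    unfolding subgroups_with_projections_def mem_Collect_eq by metis
  then show ?thesis
    by (auto simp: orbit_conj_action[OF L] orbit_conj_action[OF L'(1)])
qed

section \<open>Assembling the transversal and the matrix\<close>

theorem theorem6p8:
  fixes G1 :: "('a, 'm) monoid_scheme" and G2 :: "('b, 'n) monoid_scheme"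
    and R1 :: "'a set set" and R2 :: "'b set set"
    and PP :: "('a set \<times> 'b set) list"
    and T :: "'a set \<Rightarrow> 'b set \<Rightarrow> ('a \<times> 'b) set list"
  assumes "group G1" and "finite (carrier G1)"
    and "group G2" and "finite (carrier G2)"
    and "is_transversal G1 (subgroups_of G1) (conj_action G1 (subgroups_of G1)) R1"
    and "is_transversal G2 (subgroups_of G2) (conj_action G2 (subgroups_of G2)) R2"
    and "distinct PP" and "set PP = R1 \<times> R2"
    and "\<And>P1 P2. P1 \<in> R1 \<Longrightarrow> P2 \<in> R2 \<Longrightarrow>
           lists_transversal (normalizer_prod G1 G2 P1 P2) (subgroups_with_projections G1 G2 P1 P2)
             (conj_action (G1 \<times>\<times> G2) (subgroups_with_projections G1 G2 P1 P2)) (T P1 P2)"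
  shows "lists_transversal (G1 \<times>\<times> G2) (subgroups_of (G1 \<times>\<times> G2))
           (conj_action (G1 \<times>\<times> G2) (subgroups_of (G1 \<times>\<times> G2)))
           (concat (map (\<lambda>(P1, P2). T P1 P2) PP))
       \<and> A_le_P G1 G2 (concat (map (\<lambda>(P1, P2). T P1 P2) PP))
           = diag_block_mat (map (\<lambda>(P1, P2). A_block G1 G2 P1 P2 (T P1 P2)) PP)"
proof -
  let ?G = "G1 \<times>\<times> G2" and ?Ls = "concat (map (\<lambda>(P1, P2). T P1 P2) PP)"
  let ?S = "subgroups_of ?G" and ?X = "subgroups_with_projections G1 G2"
  let ?\<phi> = "conj_action ?G ?S"
  let ?N = "normalizer_prod G1 G2"
  note G = assms(1,3)
  interpret a1: group_action G1 "subgroups_of G1" "conj_action G1 (subgroups_of G1)"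
    by (rule conj_action_subgroups_of[OF G(1)])
  interpret a2: group_action G2 "subgroups_of G2" "conj_action G2 (subgroups_of G2)"
    by (rule conj_action_subgroups_of[OF G(2)])
  interpret act: group_action ?G ?S ?\<phi>
    by (intro conj_action_subgroups_of DirProd_group G)
  note R1 = assms(5)[unfolded a1.is_transversal_iff]
  note R2 = assms(6)[unfolded a2.is_transversal_iff]
  have XS: "?X P1 P2 \<subseteq> ?S" for P1 P2
    by (auto simp: subgroups_with_projections_def)
  \<comment> \<open>The transversal property for the product of normalizers is restated with orbits
    of the full product; within \<open>?X P1 P2\<close> the two kinds of orbit agree by
    \<open>orbit_normalizer_prod\<close>.\<close>
  have T: "distinct (T P1 P2)" "set (T P1 P2) \<subseteq> ?X P1 P2"
    and Tex: "\<And>L. L \<in> ?X P1 P2 \<Longrightarrow> \<exists>t\<in>set (T P1 P2). t \<in> orbit ?G ?\<phi> L"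
    and Tun: "\<And>s t. \<lbrakk>s \<in> set (T P1 P2); t \<in> set (T P1 P2); t \<in> orbit ?G ?\<phi> s\<rbrakk> \<Longrightarrow> t = s"
    if P: "P1 \<in> R1" "P2 \<in> R2" for P1 P2
  proof -
    have "subgroup P1 G1" "subgroup P2 G2"
      using R1 R2 P by (auto simp: subgroups_of_def)
    then interpret b: finite_G_poset "?N P1 P2" "?X P1 P2" "conj_action ?G (?X P1 P2)" "(\<subseteq>)"
      by (rule finite_G_poset_block[OF assms(1-4)])
    note tr = assms(9)[OF P, unfolded lists_transversal_def b.is_transversal_iff]
    show "distinct (T P1 P2)" and sub: "set (T P1 P2) \<subseteq> ?X P1 P2" using tr by auto
    show "\<exists>t\<in>set (T P1 P2). t \<in> orbit ?G ?\<phi> L" if "L \<in> ?X P1 P2" for L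
      using tr that orbit_normalizer_prod[OF G that] by blast
    show "t = s" if "s \<in> set (T P1 P2)" "t \<in> set (T P1 P2)" "t \<in> orbit ?G ?\<phi> s" for s t
    proof -
      have "s \<in> ?X P1 P2" "t \<in> ?X P1 P2" using sub that by auto
      then show ?thesis using tr that orbit_normalizer_prod[OF G, of s P1 P2] by blast
    qed
  qed
  \<comment> \<open>Conjugate subgroups have conjugate projections, and \<open>R1\<close> and
    \<open>R2\<close> contain only one member of each class.\<close>
  have same: "P1 = Q1 \<and> P2 = Q2"
    if "P1 \<in> R1" "P2 \<in> R2" "Q1 \<in> R1" "Q2 \<in> R2" "L \<in> ?X P1 P2" "K \<in> ?X Q1 Q2"
      "K \<in> orbit ?G ?\<phi> L" for P1 P2 Q1 Q2 L K
  proof -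
    have L: "subgroup L ?G" and eq: "fst ` L = P1" "snd ` L = P2" "fst ` K = Q1" "snd ` K = Q2"
      using that(5,6) by (simp_all add: subgroups_with_projections_def subgroups_of_def)
    show ?thesis
      using orbit_projections[OF G L that(7), unfolded eq] R1 R2 that(1-4) by blast
  qed
  have disj: "set (T P1 P2) \<inter> set (T Q1 Q2) = {}"
    if "P1 \<in> R1" "P2 \<in> R2" "Q1 \<in> R1" "Q2 \<in> R2" "(P1, P2) \<noteq> (Q1, Q2)" for P1 P2 Q1 Q2
    using T(2)[OF that(1,2)] T(2)[OF that(3,4)] that(5)
    by (auto simp: subgroups_with_projections_def)
  have ex: "\<exists>t\<in>set ?Ls. t \<in> orbit ?G ?\<phi> L" if L: "L \<in> ?S" for L
  proof -
    have subs: "fst ` L \<in> subgroups_of G1" "snd ` L \<in> subgroups_of G2"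
      using L subgroup_fst_image[OF G] subgroup_snd_image[OF G] by (auto simp: subgroups_of_def)
    obtain P1 P2 where P: "P1 \<in> R1" "P1 \<in> orbit G1 (conj_action G1 (subgroups_of G1)) (fst ` L)"
      "P2 \<in> R2" "P2 \<in> orbit G2 (conj_action G2 (subgroups_of G2)) (snd ` L)"
      using R1 R2 subs by meson
    then obtain g1 g2 where g: "g1 \<in> carrier G1" "P1 = g1 <#\<^bsub>G1\<^esub> fst ` L #>\<^bsub>G1\<^esub> (inv\<^bsub>G1\<^esub> g1)"
      "g2 \<in> carrier G2" "P2 = g2 <#\<^bsub>G2\<^esub> snd ` L #>\<^bsub>G2\<^esub> (inv\<^bsub>G2\<^esub> g2)"
      by (auto simp: orbit_conj_action[OF subs(1)] orbit_conj_action[OF subs(2)])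
    \<comment> \<open>The elements \<open>g1\<close> and \<open>g2\<close> are chosen independently,
      and the pair moves both projections of \<open>L\<close> to their representatives at once. The
      conjugate \<open>K\<close> then lies in \<open>?X P1 P2\<close>, where \<open>T P1 P2\<close>
      meets its orbit.\<close>
    define K where "K = ?\<phi> (g1, g2) L"
    have gG: "(g1, g2) \<in> carrier ?G" using g by simp
    have K: "K \<in> ?S" using act.element_image[OF gG L] by (simp add: K_def)
    moreover have "fst ` K = P1" "snd ` K = P2"
      using fst_conj[OF G gG] snd_conj[OF G gG] g L by (simp_all add: K_def conj_action_def)
    ultimately have "K \<in> ?X P1 P2" by (simp add: subgroups_with_projections_def)
    then obtain t where t: "t \<in> set (T P1 P2)" "t \<in> orbit ?G ?\<phi> K"
      using Tex P by blast
    have "K \<in> orbit ?G ?\<phi> L" using gG by (auto simp: orbit_def K_def)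
    moreover have "t \<in> ?S" using t T(2) P XS by blast
    ultimately have "t \<in> orbit ?G ?\<phi> L" using act.orbit_trans L K t(2) by blast
    then show ?thesis using t P assms(8) by auto
  qed
  \<comment> \<open>By \<open>same\<close>, conjugate members of the list come from the same block,
    where \<open>Tun\<close> applies.\<close>
  have un: "t = s" if st: "s \<in> set ?Ls" "t \<in> set ?Ls" "t \<in> orbit ?G ?\<phi> s" for s t
  proof -
    obtain P1 P2 Q1 Q2 where P: "P1 \<in> R1" "P2 \<in> R2" "s \<in> set (T P1 P2)"
      and Q: "Q1 \<in> R1" "Q2 \<in> R2" "t \<in> set (T Q1 Q2)"
      using st assms(8) by auto
    then have "P1 = Q1 \<and> P2 = Q2"
      using same[OF P(1,2) Q(1,2)] T(2) st(3) by blast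
    then show ?thesis using Tun P Q st by blast
  qed
  have "distinct (concat (map (\<lambda>(P1, P2). T P1 P2) PP))"
  proof -
    \<comment> \<open>The induction needs an inclusion in \<open>R1 \<times> R2\<close>, which
      passes to tails, in place of the equality known for \<open>PP\<close>.\<close>
    have "distinct (concat (map (\<lambda>(P1, P2). T P1 P2) PS))"
      if "distinct PS" "set PS \<subseteq> R1 \<times> R2" for PS
      using that
    proof (induction PS)
      case (Cons p PS)
      obtain P1 P2 where p: "p = (P1, P2)" by (cases p)
      have "set (T P1 P2) \<inter> set (T Q1 Q2) = {}" if "(Q1, Q2) \<in> set PS" for Q1 Q2
        using Cons.prems p that by (intro disj) auto
      then show ?case using Cons p T(1) by fastforce
    qed simp
    then show ?thesis using assms(7,8) by simp
  qed
  moreover have "set ?Ls \<subseteq> ?S" using T(2) XS assms(8) by fastforce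
  ultimately have "lists_transversal ?G ?S ?\<phi> ?Ls"
    unfolding lists_transversal_def act.is_transversal_iff using ex un by blast
  moreover have "A_le_P G1 G2 ?Ls
      = diag_block_mat (map (\<lambda>(P1, P2). A_block G1 G2 P1 P2 (T P1 P2)) PP)"
  proof -
    let ?F = "\<lambda>x y. int (class_incidence ?G ?S ?\<phi> (\<le>\<^sub>P) x y)"
    let ?M = "\<lambda>xs. mat (length xs) (length xs) (\<lambda>(i, j). ?F (xs ! i) (xs ! j))"
    have "A_le_P G1 G2 ?Ls = ?M ?Ls" by (simp add: A_le_P_def class_incidence_mat_def)
    also have "\<dots> = diag_block_mat (map (\<lambda>p. ?M ((\<lambda>(P1, P2). T P1 P2) p)) PP)"
    proof (rule mat_concat_eq_diag_block_mat[OF assms(7)])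
      fix p q x y
      assume pq: "p \<in> set PP" "q \<in> set PP" "p \<noteq> q"
        "x \<in> set ((\<lambda>(P1, P2). T P1 P2) p)" "y \<in> set ((\<lambda>(P1, P2). T P1 P2) q)"
      obtain P1 P2 Q1 Q2 where p: "p = (P1, P2)" and q: "q = (Q1, Q2)"
        by (cases p, cases q)
      have P: "P1 \<in> R1" "P2 \<in> R2" "Q1 \<in> R1" "Q2 \<in> R2" using pq p q assms(8) by auto
      have x: "x \<in> ?X P1 P2" and y: "y \<in> ?X Q1 Q2" using pq p q P T(2) by auto
      \<comment> \<open>A subgroup above \<open>y\<close> inherits the projections of
        \<open>y\<close>. If it were also conjugate to \<open>x\<close>, then \<open>same\<close>
        would force \<open>p = q\<close>, so an entry between different blocks counts
        nothing.\<close>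
      have "x' \<in> ?X Q1 Q2" if "x' \<in> ?S" "y \<le>\<^sub>P x'" for x'
        using that y by (simp add: subgroups_with_projections_def le_P_def)
      then have "{x' \<in> ?S. x' \<in> orbit ?G ?\<phi> x \<and> y \<le>\<^sub>P x'} = {}"
        using same[OF P x] pq(3) p q by blast
      then show "?F x y = 0" unfolding class_incidence_def by (simp only: card.empty of_nat_0)
    qed
    also have "map (\<lambda>p. ?M ((\<lambda>(P1, P2). T P1 P2) p)) PP
        = map (\<lambda>(P1, P2). A_block G1 G2 P1 P2 (T P1 P2)) PP"
    proof (rule map_cong[OF refl])
      fix p assume "p \<in> set PP"
      then obtain P1 P2 where p: "p = (P1, P2)" and P: "P1 \<in> R1" "P2 \<in> R2"
        using assms(8) by auto
      have "class_incidence ?G ?S ?\<phi> (\<le>\<^sub>P) x y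
          = class_incidence (?N P1 P2) (?X P1 P2) (conj_action ?G (?X P1 P2)) (\<subseteq>) x y"
        if "x \<in> set (T P1 P2)" "y \<in> set (T P1 P2)" for x y
      proof -
        have x: "x \<in> ?X P1 P2" and y: "y \<in> ?X P1 P2" using that T(2) P by auto
        \<comment> \<open>As \<open>y\<close> has projections \<open>P1\<close> and
          \<open>P2\<close>, the relation \<open>y \<le>\<^sub>P x'\<close> says that
          \<open>x'\<close> lies in \<open>?X P1 P2\<close> and contains \<open>y\<close>.
          Restricting the full orbit of \<open>x\<close> to \<open>?X P1 P2\<close> leaves its orbit
          under the product of normalizers.\<close>
        have "{x' \<in> ?S. x' \<in> orbit ?G ?\<phi> x \<and> y \<le>\<^sub>P x'} =
            {x' \<in> ?X P1 P2. x' \<in> orbit (?N P1 P2) (conj_action ?G (?X P1 P2)) x \<and> y \<subseteq> x'}"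
          using y unfolding orbit_normalizer_prod[OF G x]
          by (auto simp: subgroups_with_projections_def le_P_def)
        then show ?thesis by (simp add: class_incidence_def)
      qed
      then show "?M ((\<lambda>(P1, P2). T P1 P2) p) = (\<lambda>(P1, P2). A_block G1 G2 P1 P2 (T P1 P2)) p"
        by (auto simp: p A_block_def class_incidence_mat_def intro!: eq_matI)
    qed
    finally show ?thesis .
  qed
  ultimately show ?thesis ..
qed

end
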